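(* A sequence $\{X_n\}$ of random variables defines an AR(1) sequence that is marginally stationary with $0<\rho<1$ if $X_n$ is SSD($\rho$).
   Context: CF means characteristic function. A CF is infinitely divisible (ID) if for every integer $n\ge 1$ it is the $n$-th power of some CF. A probability distribution on $\mathbf{R}$ with CF $f$ is semi-selfdecomposable, written SSD($b$), if there exists a CF $f_o$ that is ID such that $f(t)=f(bt)\,f_o(t)$, for some $0<b<1$ and for all $t\in\mathbf{R}$. A random variable is SSD($b$) if its distribution is. The (linear additive) AR(1) scheme is described by a sequence of random variables $\{X_n\}$ and innovations $\{\varepsilon_n\}$, where the $\{\varepsilon_n\}$ are i.i.d., satisfying $X_n=\rho X_{n-1}+\varepsilon_n$ for some $0<\rho<1$. Marginally stationary means that all the $X_n$ have the same distribution. *)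

theory Defs
  imports "HOL-Probability.Probability"
begin

definition characteristic_function :: "(real \<Rightarrow> complex) \<Rightarrow> bool" where
  "characteristic_function f \<longleftrightarrow> (\<exists>N. real_distribution N \<and> f = char N)"

definition infinitely_divisible :: "(real \<Rightarrow> complex) \<Rightarrow> bool" where
  "infinitely_divisible f \<longleftrightarrow>
     characteristic_function f \<and>
     (\<forall>n\<ge>1::nat. \<exists>g. characteristic_function g \<and> (\<forall>t. f t = g t ^ n))"

definition SSD :: "real \<Rightarrow> real measure \<Rightarrow> bool" where
  "SSD b \<mu> \<longleftrightarrow>
     real_distribution \<mu> \<and> 0 < b \<and> b < 1 \<and>
     (\<exists>f\<^sub>o. infinitely_divisible f\<^sub>o \<and> (\<forall>t. char \<mu> t = char \<mu> (b * t) * f\<^sub>o t))"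

text \<open>
  The scheme is started at time 0; the innovations are \<open>\<epsilon> 1, \<epsilon> 2, \<dots>\<close>, and \<open>\<epsilon> 0\<close> is a
  dummy.  The joint independence of \<open>X 0, \<epsilon> 1, \<epsilon> 2, \<dots>\<close> contains that of the innovations and
  adds the usual convention that \<open>\<epsilon> n\<close> is independent of \<open>X 0, \<dots>, X (n - 1)\<close> for \<open>n \<ge> 1\<close>.
\<close>

definition AR1_scheme ::
  "real \<Rightarrow> 'a measure \<Rightarrow> (nat \<Rightarrow> 'a \<Rightarrow> real) \<Rightarrow> (nat \<Rightarrow> 'a \<Rightarrow> real) \<Rightarrow> bool" where
  "AR1_scheme \<rho> M X \<epsilon> \<longleftrightarrow>
     prob_space M \<and> 0 < \<rho> \<and> \<rho> < 1 \<and>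
     (\<forall>n. X n \<in> borel_measurable M) \<and>
     (\<forall>n\<ge>1. \<forall>\<omega>\<in>space M. X n \<omega> = \<rho> * X (n - 1) \<omega> + \<epsilon> n \<omega>) \<and>
     prob_space.indep_vars M (\<lambda>_. borel) (\<epsilon>(0 := X 0)) UNIV \<and>
     (\<forall>m\<ge>1. \<forall>n\<ge>1. distr M borel (\<epsilon> m) = distr M borel (\<epsilon> n))"

definition marginally_stationary :: "'a measure \<Rightarrow> (nat \<Rightarrow> 'a \<Rightarrow> real) \<Rightarrow> bool" where
  "marginally_stationary M X \<longleftrightarrow> (\<forall>m n. distr M borel (X m) = distr M borel (X n))"

end

theory Submission
  imports Defs
begin

text \<open>
  Let \<open>\<nu>\<close> be the distribution whose characteristic function is the factor \<open>f\<^sub>o\<close> of the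
  SSD decomposition \<open>char \<mu> t = char \<mu> (\<rho> * t) * f\<^sub>o t\<close>.  Read probabilistically, this
  identity says that \<open>\<mu>\<close> is a fixed point of the one-step transition of the scheme: if \<open>Y\<close> has
  distribution \<open>\<mu>\<close> and \<open>e\<close> is independent of \<open>Y\<close> with distribution \<open>\<nu>\<close>, then
  \<open>\<rho> * Y + e\<close> has distribution \<open>\<mu>\<close> again, by Levy's uniqueness theorem
  (\<open>SSD_transition_invariant\<close>).

  It remains to realise such variables jointly.  On the infinite product of \<open>\<mu>\<close> (coordinate 0) and
  copies of \<open>\<nu>\<close> (the other coordinates) the coordinates are independent with the prescribed
  marginals (\<open>indep_vars_PiM_coordinates\<close>).  They serve as starting value and
  innovations, and the recursion defines the process.  Its value at time \<open>n\<close> is a function of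
  coordinates \<open>0, \<dots>, n\<close> only, hence independent of coordinate \<open>n + 1\<close>
  (\<open>indep_var_AR1_path_next\<close>), so invariance of \<open>\<mu>\<close> propagates by induction.
\<close>

lemma char_distr_mult_left:
  fixes X :: "'a \<Rightarrow> real"
  assumes [measurable]: "X \<in> borel_measurable M"
  shows "char (distr M borel (\<lambda>\<omega>. c * X \<omega>)) t = char (distr M borel X) (c * t)"
  by (simp add: char_def integral_distr mult_ac)

lemma SSD_transition_invariant:
  fixes Y e :: "'a \<Rightarrow> real"
  assumes "prob_space M" and "real_distribution \<mu>"
    and char: "\<And>t. char \<mu> t = char \<mu> (\<rho> * t) * char \<nu> t"
    and indep: "prob_space.indep_var M borel Y borel e"
    and Y: "distr M borel Y = \<mu>" and e: "distr M borel e = \<nu>"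
  shows "distr M borel (\<lambda>\<omega>. \<rho> * Y \<omega> + e \<omega>) = \<mu>"
proof -
  interpret prob_space M by fact
  have [measurable]: "Y \<in> borel_measurable M" "e \<in> borel_measurable M"
    using indep by (rule indep_var_rv1, rule indep_var_rv2)
  have "indep_var borel ((\<lambda>y. \<rho> * y) \<circ> Y) borel ((\<lambda>x. x) \<circ> e)"
    by (rule indep_var_compose[OF indep]) auto
  then have "indep_var borel (\<lambda>\<omega>. \<rho> * Y \<omega>) borel e"
    by (simp add: comp_def)
  from char_distr_add[OF this]
  have "char (distr M borel (\<lambda>\<omega>. \<rho> * Y \<omega> + e \<omega>)) = char \<mu>"
    by (simp add: fun_eq_iff char_distr_mult_left Y e char[symmetric])
  then show ?thesis
    by (intro Levy_uniqueness assms real_distribution_distr) auto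
qed

lemma indep_vars_PiM_coordinates:
  fixes N :: "'i \<Rightarrow> 'b measure"
  assumes "I \<noteq> {}" and N: "\<And>i. i \<in> I \<Longrightarrow> prob_space (N i)"
  shows "prob_space.indep_vars (PiM I N) N (\<lambda>i \<omega>. \<omega> i) I"
proof -
  interpret prob_space "PiM I N"
    by (rule prob_space_PiM) (rule N)
  have "distr (PiM I N) (PiM I N) (\<lambda>\<omega>. \<lambda>i\<in>I. \<omega> i) = distr (PiM I N) (PiM I N) (\<lambda>\<omega>. \<omega>)"
    by (rule distr_cong) (auto simp: space_PiM PiE_def extensional_restrict)
  also have "\<dots> = PiM I (\<lambda>i. distr (PiM I N) (N i) (\<lambda>\<omega>. \<omega> i))"
    by (auto intro!: PiM_cong simp: distr_PiM_component N)
  finally show ?thesis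
    by (subst indep_vars_iff_distr_eq_PiM') (auto simp: \<open>I \<noteq> {}\<close>)
qed

fun AR1_path :: "real \<Rightarrow> nat \<Rightarrow> (nat \<Rightarrow> real) \<Rightarrow> real" where
  "AR1_path \<rho> 0 \<omega> = \<omega> 0"
| "AR1_path \<rho> (Suc n) \<omega> = \<rho> * AR1_path \<rho> n \<omega> + \<omega> (Suc n)"

lemma AR1_path_measurable:
  assumes "{..n} \<subseteq> I"
  shows "AR1_path \<rho> n \<in> borel_measurable (PiM I (\<lambda>_. borel))"
  using assms
proof (induction n)
  case (Suc n)
  have [measurable]: "(\<lambda>\<omega>. \<omega> (Suc n)) \<in> borel_measurable (PiM I (\<lambda>_. borel :: real measure))"
    using Suc.prems by (intro measurable_component_singleton) auto
  have [measurable]: "AR1_path \<rho> n \<in> borel_measurable (PiM I (\<lambda>_. borel))"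
    using Suc.prems by (intro Suc.IH) auto
  have "(\<lambda>\<omega>. \<rho> * AR1_path \<rho> n \<omega> + \<omega> (Suc n)) \<in> borel_measurable (PiM I (\<lambda>_. borel))"
    by measurable
  then show ?case
    by (simp add: fun_eq_iff cong: measurable_cong)
next
  case 0
  then have "(\<lambda>\<omega>. \<omega> 0) \<in> borel_measurable (PiM I (\<lambda>_. borel :: real measure))"
    by (intro measurable_component_singleton) auto
  then show ?case
    by (simp cong: measurable_cong)
qed

lemma AR1_path_restrict:
  "{..n} \<subseteq> I \<Longrightarrow> AR1_path \<rho> n (restrict \<omega> I) = AR1_path \<rho> n \<omega>"
  by (induction n) (auto simp: subset_iff)

text \<open>
  The path up to time \<open>n\<close> factors through the coordinates in \<open>{..n}\<close>, a set disjoint from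
  \<open>{Suc n}\<close>; disjoint blocks of an independent family are independent.
\<close>

lemma indep_var_AR1_path_next:
  assumes "prob_space M"
    and "prob_space.indep_vars M (\<lambda>_. borel) (\<lambda>i \<omega>. \<omega> i) UNIV"
  shows "prob_space.indep_var M borel (AR1_path \<rho> n) borel (\<lambda>\<omega>. \<omega> (Suc n))"
proof -
  interpret prob_space M by fact
  have "indep_var (PiM {..n} (\<lambda>_. borel)) (\<lambda>\<omega>. restrict (\<lambda>i. \<omega> i) {..n})
                  (PiM {Suc n} (\<lambda>_. borel)) (\<lambda>\<omega>. restrict (\<lambda>i. \<omega> i) {Suc n})"
    by (rule indep_var_restrict[OF assms(2)]) auto
  then have "indep_var borel (AR1_path \<rho> n \<circ> (\<lambda>\<omega>. restrict (\<lambda>i. \<omega> i) {..n}))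
                       borel ((\<lambda>\<omega>. \<omega> (Suc n)) \<circ> (\<lambda>\<omega>. restrict (\<lambda>i. \<omega> i) {Suc n}))"
    by (rule indep_var_compose)
       (auto intro!: AR1_path_measurable measurable_component_singleton)
  then show ?thesis
    by (simp add: comp_def AR1_path_restrict)
qed

theorem mainTheorem2:
  fixes \<rho> :: real and \<mu> :: "real measure"
  assumes "0 < \<rho>" and "\<rho> < 1"
    and "SSD \<rho> \<mu>"
  shows "\<exists>(M :: (nat \<Rightarrow> real) measure) X \<epsilon>.
           AR1_scheme \<rho> M X \<epsilon> \<and>
           marginally_stationary M X \<and>
           (\<forall>n. distr M borel (X n) = \<mu>)"
proof -
  from assms(3) obtain \<nu> where \<mu>: "real_distribution \<mu>" and \<nu>: "real_distribution \<nu>"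
    and char: "\<And>t. char \<mu> t = char \<mu> (\<rho> * t) * char \<nu> t"
    unfolding SSD_def infinitely_divisible_def characteristic_function_def by blast
  define N where "N = (\<lambda>i::nat. if i = 0 then \<mu> else \<nu>)"
  define M where "M = PiM UNIV N"
  have N: "real_distribution (N i)" for i
    using \<mu> \<nu> by (simp add: N_def)
  then have N_prob: "prob_space (N i)" and sets_N: "sets (N i) = sets borel" for i
    by (auto simp: real_distribution_def real_distribution.events_eq_borel)
  interpret prob_space M
    unfolding M_def by (intro prob_space_PiM N_prob)
  have coord_distr: "distr M borel (\<lambda>\<omega>. \<omega> i) = N i" for i
  proof -
    have "distr M borel (\<lambda>\<omega>. \<omega> i) = distr M (N i) (\<lambda>\<omega>. \<omega> i)"
      by (rule distr_cong) (auto simp: sets_N)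
    then show ?thesis
      by (simp add: M_def distr_PiM_component N_prob)
  qed
  have "indep_vars N (\<lambda>i \<omega>. \<omega> i) UNIV"
    unfolding M_def by (rule indep_vars_PiM_coordinates) (auto intro: N_prob)
  then have "indep_vars (\<lambda>_. borel) (\<lambda>i. (\<lambda>x. x) \<circ> (\<lambda>\<omega>. \<omega> i)) UNIV"
    by (rule indep_vars_compose) (auto intro!: measurable_ident_sets simp: sets_N)
  then have indep: "indep_vars (\<lambda>_. borel) (\<lambda>i \<omega>. \<omega> i) UNIV"
    by (simp add: comp_def)
  have sets_M: "sets M = sets (PiM UNIV (\<lambda>_. borel))"
    unfolding M_def by (intro sets_PiM_cong) (auto simp: sets_N)
  have path_meas: "AR1_path \<rho> n \<in> borel_measurable M" for n
    using AR1_path_measurable[of n UNIV \<rho>] by (simp add: measurable_cong_sets[OF sets_M refl])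
  have path_distr: "distr M borel (AR1_path \<rho> n) = \<mu>" for n
  proof (induction n)
    case 0
    have "AR1_path \<rho> 0 = (\<lambda>\<omega>. \<omega> 0)" by auto
    then show ?case using coord_distr[of 0] by (simp add: N_def)
  next
    case (Suc n)
    have "distr M borel (\<lambda>\<omega>. \<omega> (Suc n)) = \<nu>"
      using coord_distr[of "Suc n"] by (simp add: N_def)
    then have "distr M borel (\<lambda>\<omega>. \<rho> * AR1_path \<rho> n \<omega> + \<omega> (Suc n)) = \<mu>"
      by (rule SSD_transition_invariant[OF prob_space_axioms \<mu> char
            indep_var_AR1_path_next[OF prob_space_axioms indep] Suc])
    moreover have "AR1_path \<rho> (Suc n) = (\<lambda>\<omega>. \<rho> * AR1_path \<rho> n \<omega> + \<omega> (Suc n))"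
      by auto
    ultimately show ?case by simp
  qed
  let ?\<epsilon> = "\<lambda>i (\<omega> :: nat \<Rightarrow> real). \<omega> i"
  have step: "AR1_path \<rho> n \<omega> = \<rho> * AR1_path \<rho> (n - 1) \<omega> + \<omega> n" if "n \<ge> 1" for n \<omega>
    using that by (cases n) auto
  \<comment> \<open>The scheme puts the starting value in the dummy slot \<open>\<epsilon> 0\<close>, where coordinate 0
      already is.\<close>
  have override: "?\<epsilon>(0 := AR1_path \<rho> 0) = ?\<epsilon>"
    by (auto simp: fun_eq_iff)
  have "AR1_scheme \<rho> M (AR1_path \<rho>) ?\<epsilon>"
    unfolding AR1_scheme_def override
    using assms(1,2) prob_space_axioms path_meas step indep coord_distr by (simp add: N_def)
  moreover have "marginally_stationary M (AR1_path \<rho>)"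
    by (simp add: marginally_stationary_def path_distr)
  ultimately show ?thesis
    using path_distr by blast
qed

end
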